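(* Let $p\ge2$ and let $\epsilon\in\mathbb{C}$ satisfy $\operatorname{Re}(\epsilon)>B^p_\epsilon$ and $\operatorname{Re}(\epsilon)\ne0$. Then the regularised quantum dimensions of the modules over the singlet vertex operator algebra $\mathcal{M}(p)$ are, for $\lambda\in\mathbb{C}$, $r\in\mathbb{Z}$ and $1\le s\le p$, $$\operatorname{qdim}[\mathcal{F}_\lambda^\epsilon]=e^{2\pi\epsilon(\lambda-\alpha_0/2)}\,\frac{\sin\left(i\pi\sqrt{2p}\,\epsilon\right)}{\sin\left(2\pi i\frac{\epsilon}{\sqrt{2p}}\right)},\qquad \operatorname{qdim}[M_{r,s}^\epsilon]=e^{\pi\epsilon(r-1)\sqrt{2p}}\,\frac{\sin\left(2\pi\frac{s\epsilon i}{\sqrt{2p}}\right)}{\sin\left(2\pi\frac{\epsilon i}{\sqrt{2p}}\right)}.$$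
   Context: Let $p\ge2$ be an integer, $\alpha_0=\sqrt{2p}-\sqrt{2/p}$, $q=e^{2\pi i\tau}$ (with $q^x:=e^{2\pi i\tau x}$), $\eta$ the Dedekind eta function. The singlet vertex operator algebra $\mathcal{M}(p)$ is the kernel of a screening operator on the rank one Heisenberg vertex algebra; $\mathcal{F}_\lambda$ ($\lambda\in\mathbb{C}$) are its Fock (standard) modules and $M_{r,s}$ ($r\in\mathbb{Z}$, $1\le s\le p$) its remaining irreducible modules, with $M_{1,1}=\mathcal{M}(p)$ the vacuum module. Only the $\epsilon$-regularised characters enter: $$\mathrm{ch}[\mathcal{F}^\epsilon_\lambda](\tau)=e^{2\pi\epsilon(\lambda-\alpha_0/2)}\frac{q^{(\lambda-\alpha_0/2)^2/2}}{\eta(\tau)},$$ $$\mathrm{ch}[M^\epsilon_{r,s}](\tau)=\frac1{\eta(\tau)}\sum_{k\ge0}\left(e^{-2\pi\epsilon\sqrt{2p}\,u_k^-}q^{p(u_k^-)^2}-e^{-2\pi\epsilon\sqrt{2p}\,u_k^+}q^{p(u_k^+)^2}\right),\qquad u_k^{\pm}=k+\tfrac{2-r}{2}\pm\tfrac{s}{2p}.$$ The regularised quantum dimension is $\operatorname{qdim}[M^\epsilon]=\lim_{y\to0^+}\mathrm{ch}[M^\epsilon](iy)/\mathrm{ch}[M_{1,1}^\epsilon](iy)$. Finally $B^p_\epsilon=-\min\{|\frac{m}{\sqrt{2p}}-\operatorname{Im}(\epsilon)| : m\in\mathbb{Z}\setminus p\mathbb{Z}\}$. *)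

theory Defs
  imports "HOL-Analysis.Analysis"
begin

text \<open>
  \<open>qpow \<tau> x\<close> is \<open>q\<^sup>x\<close> for \<open>q = e\<^sup>2\<^sup>\<pi>\<^sup>i\<^sup>\<tau>\<close>. It is a function of \<open>\<tau>\<close> rather than of \<open>q\<close>, because for
  non-integral \<open>x\<close> a power of \<open>q\<close> would depend on a branch of the logarithm.
\<close>
definition qpow :: "complex \<Rightarrow> complex \<Rightarrow> complex" where
  "qpow \<tau> x = exp (2 * of_real pi * \<i> * \<tau> * x)"

definition dedekind_eta :: "complex \<Rightarrow> complex" where
  "dedekind_eta \<tau> = qpow \<tau> (1 / 24) * (\<Prod>n. 1 - qpow \<tau> (of_nat (Suc n)))"

definition alpha0 :: "nat \<Rightarrow> real" where
  "alpha0 p = sqrt (2 * real p) - sqrt (2 / real p)"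

definition u_minus :: "nat \<Rightarrow> int \<Rightarrow> nat \<Rightarrow> nat \<Rightarrow> real" where
  "u_minus p r s k = real k + (2 - real_of_int r) / 2 - real s / (2 * real p)"

definition u_plus :: "nat \<Rightarrow> int \<Rightarrow> nat \<Rightarrow> nat \<Rightarrow> real" where
  "u_plus p r s k = real k + (2 - real_of_int r) / 2 + real s / (2 * real p)"

text \<open>
  Modules over the singlet vertex operator algebra \<open>\<M>(p)\<close> are represented by their labels:
  \<open>Fock \<lambda>\<close> stands for \<open>\<F>\<^sub>\<lambda>\<close>, and \<open>Irr r s\<close> for \<open>M\<^sub>r\<^sub>,\<^sub>s\<close>, which is meaningful only for \<open>1 \<le> s \<le> p\<close>.
\<close>
datatype singlet_module = Fock complex | Irr int nat

abbreviation vacuum :: singlet_module where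
  "vacuum \<equiv> Irr 1 1"

fun reg_ch :: "nat \<Rightarrow> complex \<Rightarrow> singlet_module \<Rightarrow> complex \<Rightarrow> complex" where
  "reg_ch p \<epsilon> (Fock l) \<tau> =
     exp (2 * of_real pi * \<epsilon> * (l - of_real (alpha0 p) / 2)) *
       qpow \<tau> ((l - of_real (alpha0 p) / 2)\<^sup>2 / 2) / dedekind_eta \<tau>"
| "reg_ch p \<epsilon> (Irr r s) \<tau> =
     1 / dedekind_eta \<tau> *
     (\<Sum>k. exp (- 2 * of_real pi * \<epsilon> * of_real (sqrt (2 * real p)) * of_real (u_minus p r s k)) *
              qpow \<tau> (of_nat p * (of_real (u_minus p r s k))\<^sup>2)
          - exp (- 2 * of_real pi * \<epsilon> * of_real (sqrt (2 * real p)) * of_real (u_plus p r s k)) *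
              qpow \<tau> (of_nat p * (of_real (u_plus p r s k))\<^sup>2))"

text \<open>\<open>has_qdim p \<epsilon> X d\<close>: the limit defining the regularised quantum dimension of \<open>X\<close> exists and
  equals \<open>d\<close>.\<close>
definition has_qdim :: "nat \<Rightarrow> complex \<Rightarrow> singlet_module \<Rightarrow> complex \<Rightarrow> bool" where
  "has_qdim p \<epsilon> X d \<longleftrightarrow>
     ((\<lambda>y::real. reg_ch p \<epsilon> X (\<i> * of_real y) / reg_ch p \<epsilon> vacuum (\<i> * of_real y)) \<longlongrightarrow> d) (at_right 0)"

definition B :: "nat \<Rightarrow> complex \<Rightarrow> real" where
  "B p \<epsilon> = - (INF m\<in>{m::int. \<not> int p dvd m}. \<bar>real_of_int m / sqrt (2 * real p) - Im \<epsilon>\<bar>)"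

text \<open>The infimum in \<open>B\<close> ranges over an infinite set, but it is a minimum.\<close>
lemma B_attained:
  assumes "p \<ge> 2"
  obtains m :: int where "\<not> int p dvd m"
    and "B p \<epsilon> = - \<bar>real_of_int m / sqrt (2 * real p) - Im \<epsilon>\<bar>"
    and "\<And>n. \<not> int p dvd n \<Longrightarrow>
      \<bar>real_of_int m / sqrt (2 * real p) - Im \<epsilon>\<bar> \<le> \<bar>real_of_int n / sqrt (2 * real p) - Im \<epsilon>\<bar>"
proof -
  define f where "f n = \<bar>real_of_int n / sqrt (2 * real p) - Im \<epsilon>\<bar>" for n :: int
  define c where "c = sqrt (2 * real p)"
  define K where "K = c * (f 1 + \<bar>Im \<epsilon>\<bar>)"
  have c: "c > 0" using assms by (simp add: c_def)
  define S where "S = {n::int. \<not> int p dvd n \<and> f n \<le> f 1}"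
  have 1: "\<not> int p dvd 1" using assms by auto
  have "S \<subseteq> {- \<lceil>K\<rceil>..\<lceil>K\<rceil>}"
  proof
    fix n assume "n \<in> S"
    then have "\<bar>real_of_int n / c - Im \<epsilon>\<bar> \<le> f 1" by (simp add: S_def f_def c_def)
    then have "\<bar>real_of_int n / c\<bar> \<le> f 1 + \<bar>Im \<epsilon>\<bar>" by linarith
    then have "\<bar>real_of_int n\<bar> \<le> K" using c by (simp add: K_def field_simps)
    then show "n \<in> {- \<lceil>K\<rceil>..\<lceil>K\<rceil>}" by simp linarith
  qed
  then have fin: "finite S" by (rule finite_subset) simp
  have "1 \<in> S" using 1 by (simp add: S_def)
  then obtain m where m: "m \<in> S" "\<And>n. n \<in> S \<Longrightarrow> f m \<le> f n"
    using ex_min_if_finite[of "f ` S"] fin by (metis (no_types, lifting) arg_min_if_finite empty_iff not_less)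
  have min: "f m \<le> f n" if "\<not> int p dvd n" for n
    using m that by (cases "f n \<le> f 1") (auto simp: S_def)
  have "(INF n\<in>{n. \<not> int p dvd n}. f n) = f m"
    by (rule cInf_eq_minimum) (use m min in \<open>auto simp: S_def\<close>)
  then show ?thesis using that[of m] m min by (simp add: S_def B_def f_def)
qed

end

theory Submission
  imports Defs "HOL-Complex_Analysis.Complex_Analysis"
    "HOL-Probability.Characteristic_Functions" "HOL-Real_Asymp.Real_Asymp"
begin

text \<open>
  In every quotient of characters the Dedekind eta function cancels, so what matters is the limit, as
  \<open>y\<close> tends to \<open>0\<close> from above, of the remaining numerators. For a Fock module the numerator is
  continuous at \<open>y = 0\<close>. For \<open>M\<^sub>r\<^sub>,\<^sub>s\<close> it is a difference of two partial theta functions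
  \<open>\<Sum>k. exp (- b (a + k) - t (a + k)\<^sup>2)\<close>, with \<open>k\<close> running through the natural numbers, where
  \<open>b = 2 \<pi> \<epsilon> sqrt (2 p)\<close>, \<open>t = 2 \<pi> p y\<close> and the two shifts are \<open>a = (2 - r) / 2 \<mp> s / (2 p)\<close>. The claim is
  that the difference always tends to the difference of the values \<open>exp (- b a) / (1 - exp (- b))\<close>
  of the geometric series at \<open>t = 0\<close>; the formulas with sines follow by dividing.

  If \<open>Re \<epsilon> > 0\<close>, the geometric series converges and dominates the partial theta functions
  (\<open>partial_theta_tendsto\<close>). If \<open>Re \<epsilon> < 0\<close>, the sum over the natural numbers is the sum over all
  integers minus the sum over the negative integers. The latter is a partial theta function for \<open>- b\<close>,
  hence covered by the first case, and it contributes the same rational function of \<open>exp (- b)\<close>. It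
  remains to see that the difference of the two sums over all integers tends to \<open>0\<close>
  (\<open>theta_diff_tendsto_0\<close>). By Poisson summation (\<open>theta_poisson\<close>) this difference is
  \<open>sqrt (\<pi> / t)\<close> times the sum over the integers \<open>n\<close> of a Gaussian factor
  \<open>exp ((b + 2 \<pi> \<i> n)\<^sup>2 / (4 t))\<close> times a difference of two phases. The phases agree if \<open>p\<close> divides \<open>n\<close>.
  For the other \<open>n\<close>, the hypothesis \<open>Re \<epsilon> > B p \<epsilon>\<close> says precisely that the real part of
  \<open>(b + 2 \<pi> \<i> n)\<^sup>2\<close> is negative, uniformly in \<open>n\<close>, so the sum is exponentially small in \<open>1 / t\<close>.

  Poisson summation for the Gaussian rests on two facts: the Fourier series of a function that is
  holomorphic near the period interval converges at the centre of that interval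
  (\<open>fourier_series_at_0\<close>), and the Gaussian integral with a complex linear term has the expected value
  (\<open>has_bochner_integral_gauss\<close>).
\<close>

section \<open>Pointwise convergence of Fourier series of holomorphic functions\<close>
definition fourier_mode :: "int \<Rightarrow> real \<Rightarrow> complex" where
  "fourier_mode n x = exp (- (2 * of_real pi * \<i> * of_int n * of_real x))"

lemma norm_fourier_mode [simp]: "norm (fourier_mode n x) = 1"
  by (simp add: fourier_mode_def norm_exp_eq_Re)

lemma continuous_fourier_mode [continuous_intros]: "continuous_on A (fourier_mode n)"
  unfolding fourier_mode_def by (intro continuous_intros)

lemma exp_two_pi_i_eq_1_iff: "exp (2 * of_real pi * \<i> * z) = 1 \<longleftrightarrow> z \<in> \<int>"
proof
  assume "exp (2 * of_real pi * \<i> * z) = 1"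
  then obtain n :: int where "Re (2 * of_real pi * \<i> * z) = 0" "Im (2 * of_real pi * \<i> * z) = of_int (2 * n) * pi"
    unfolding exp_eq_1 by blast
  hence "z = of_int n" by (auto simp: complex_eq_iff)
  thus "z \<in> \<int>" by simp
next
  assume "z \<in> \<int>"
  then obtain n where "z = of_int n" by (auto elim: Ints_cases)
  thus "exp (2 * of_real pi * \<i> * z) = 1"
    using exp_integer_2pi[of "of_int n"] by (simp add: mult_ac)
qed

lemma not_Ints_of_norm_less_1:
  fixes z :: complex
  assumes "norm z < 1" "z \<noteq> 0" shows "z \<notin> \<int>"
  using assms by (auto elim!: Ints_cases)

text \<open>
  The step that makes the Fourier series telescope: both numerator and denominator of
  \<open>(F z - F 0) / (exp (2 \<pi> \<i> z) - 1)\<close> vanish at \<open>0\<close>, which is the only zero of the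
  denominator in the unit disc and a simple one. So the quotient extends holomorphically, as the
  quotient of the two difference quotients.
\<close>
lemma fourier_difference_quotient:
  assumes F: "F holomorphic_on ball (0::complex) 1"
  obtains H where "H holomorphic_on ball 0 1"
    and "\<And>z. z \<in> ball 0 1 \<Longrightarrow> F z = F 0 + (exp (2 * of_real pi * \<i> * z) - 1) * H z"
proof -
  define E where "E z = exp (2 * of_real pi * \<i> * z)" for z :: complex
  define Q where "Q f z = (if z = 0 then deriv f 0 else (f z - f 0) / (z - 0))" for f :: "complex \<Rightarrow> complex" and z
  have E: "E holomorphic_on ball 0 1"
    unfolding E_def by (intro holomorphic_intros)
  have dE: "deriv E 0 = 2 * of_real pi * \<i>"
    unfolding E_def by (rule DERIV_imp_deriv) (auto intro!: derivative_eq_intros)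
  have Qhol: "Q f holomorphic_on ball 0 1" if "f holomorphic_on ball 0 1" for f
    using pole_lemma_open[OF that, of 0] by (simp add: Q_def[abs_def])
  have nz: "Q E z \<noteq> 0" if "z \<in> ball 0 1" for z
    using that exp_two_pi_i_eq_1_iff[of z] not_Ints_of_norm_less_1[of z]
    by (auto simp: Q_def dE E_def)
  have "(\<lambda>z. Q F z / Q E z) holomorphic_on ball 0 1"
    by (intro holomorphic_intros Qhol E F nz)
  moreover have "F z = F 0 + (exp (2 * of_real pi * \<i> * z) - 1) * (Q F z / Q E z)" if "z \<in> ball 0 1" for z
  proof (cases "z = 0")
    case False
    with nz[OF that] show ?thesis by (auto simp: Q_def E_def field_simps)
  qed auto
  ultimately show ?thesis using that by blast
qed

definition fourier_coeff :: "(complex \<Rightarrow> complex) \<Rightarrow> int \<Rightarrow> complex" where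
  "fourier_coeff F n = integral {-1/2..1/2} (\<lambda>x. F (of_real x) * fourier_mode n x)"

text \<open>
  The period interval is centred at \<open>0\<close>, so that it lies in a disc in which \<open>0\<close> is the only integer.
\<close>
lemma segment_in_unit_ball: "x \<in> {-1/2..1/2} \<Longrightarrow> complex_of_real x \<in> ball 0 1"
  by (auto simp: abs_if)

lemma continuous_on_segment:
  assumes "H holomorphic_on ball 0 1"
  shows "continuous_on {-1/2..1/2} (\<lambda>x. H (complex_of_real x))"
  by (rule continuous_on_compose2[OF holomorphic_on_imp_continuous_on[OF assms]])
     (auto intro!: continuous_intros segment_in_unit_ball simp del: mem_ball)

text \<open>
  Integration by parts. As \<open>H\<close> need not be periodic, the boundary terms stay and the decay is only
  \<open>1 / n\<close>; this is enough for the telescoping argument.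
\<close>
lemma fourier_coeff_decay:
  assumes H: "H holomorphic_on ball 0 1"
  obtains K where "\<And>n. norm (of_int n * fourier_coeff H n) \<le> K"
proof -
  have H': "deriv H holomorphic_on ball 0 1" using H by (intro holomorphic_deriv) auto
  note c = continuous_on_segment[OF H] continuous_on_segment[OF H']
  obtain M where M: "\<And>x. x \<in> {-1/2..1/2} \<Longrightarrow> norm (deriv H (complex_of_real x)) \<le> M"
    using compact_imp_bounded[OF compact_continuous_image[OF c(2)]] by (fastforce simp: bounded_iff)
  define h where "h n x = H (complex_of_real x) * fourier_mode n x" for n and x :: real
  define h' where "h' n x = deriv H (complex_of_real x) * fourier_mode n x" for n and x :: real
  have bd: "norm (of_int n * fourier_coeff H n) \<le> norm (H (1/2)) + norm (H (-1/2)) + M" for n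
  proof -
    have "((\<lambda>x. h' n x - 2 * of_real pi * \<i> * of_int n * h n x) has_integral h n (1/2) - h n (-1/2)) {-1/2..1/2}"
    proof (rule fundamental_theorem_of_calculus)
      fix x :: real assume x: "x \<in> {-1/2..1/2}"
      have "(H has_field_derivative deriv H (of_real x)) (at (of_real x))"
        using H segment_in_unit_ball[OF x] by (intro holomorphic_derivI[of _ "ball 0 1"]) auto
      hence "((\<lambda>z. H z * exp (- (2 * of_real pi * \<i> * of_int n * z))) has_field_derivative
          h' n x - 2 * of_real pi * \<i> * of_int n * h n x) (at (of_real x))"
        unfolding h_def h'_def fourier_mode_def
        by (auto intro!: derivative_eq_intros simp: field_simps)
      from has_vector_derivative_real_field[OF this]
      show "(h n has_vector_derivative h' n x - 2 * of_real pi * \<i> * of_int n * h n x) (at x within {-1/2..1/2})"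
        by (simp add: h_def[abs_def] fourier_mode_def o_def)
    qed auto
    moreover have ih: "h n integrable_on {-1/2..1/2}" and ih': "h' n integrable_on {-1/2..1/2}"
      unfolding h_def[abs_def] h'_def[abs_def]
      by (intro integrable_continuous_interval continuous_intros c)+
    ultimately have eq: "integral {-1/2..1/2} (h' n) - 2 * of_real pi * \<i> * of_int n * integral {-1/2..1/2} (h n)
        = h n (1/2) - h n (-1/2)"
      by (intro has_integral_unique[OF _ \<open>(_ has_integral _) _\<close>] has_integral_diff has_integral_mult_right
            integrable_integral)
    have "norm (integral {-1/2..1/2} (h' n)) \<le> M * (1/2 - (-1/2))"
      unfolding h'_def[abs_def]
    proof (rule integral_bound)
      show "continuous_on {-1/2..1/2} (\<lambda>x. deriv H (complex_of_real x) * fourier_mode n x)"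
        by (intro continuous_intros c)
      show "norm (deriv H (complex_of_real x) * fourier_mode n x) \<le> M" if "x \<in> {-1/2..1/2}" for x
        using M[OF that] by (simp add: norm_mult)
    qed simp
    hence i: "norm (integral {-1/2..1/2} (h' n)) \<le> M" by simp
    have rearrange: "b = a - c + d" if "a - b = c - d" for a b c d :: complex
      using that by (simp add: algebra_simps)
    have "norm (2 * of_real pi * \<i> * of_int n * integral {-1/2..1/2} (h n))
        = norm (integral {-1/2..1/2} (h' n) - h n (1/2) + h n (-1/2))"
      using rearrange[OF eq] by (rule arg_cong)
    also have "\<dots> \<le> M + norm (h n (1/2)) + norm (h n (-1/2))"
      using i norm_triangle_ineq4[of "integral {-1/2..1/2} (h' n)" "h n (1/2)"]
        norm_triangle_ineq[of "integral {-1/2..1/2} (h' n) - h n (1/2)" "h n (-1/2)"] by linarith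
    also have "\<dots> = norm (H (1/2)) + norm (H (-1/2)) + M"
      by (simp add: h_def norm_mult)
    finally have *: "norm (2 * of_real pi * \<i> * of_int n * integral {-1/2..1/2} (h n)) \<le> norm (H (1/2)) + norm (H (-1/2)) + M" .
    have "norm (of_int n * integral {-1/2..1/2} (h n)) \<le> (2 * pi) * norm (of_int n * integral {-1/2..1/2} (h n))"
      using mult_right_mono[of 1 "2 * pi" "norm (of_int n * integral {-1/2..1/2} (h n))"] pi_gt3 by simp
    also have "\<dots> = norm (2 * of_real pi * \<i> * of_int n * integral {-1/2..1/2} (h n))"
      by (simp add: norm_mult)
    finally show ?thesis using * by (simp add: h_def[abs_def] fourier_coeff_def)
  qed
  thus ?thesis using that by blast
qed

lemma fourier_mode_shift:
  "exp (2 * of_real pi * \<i> * of_real x) * fourier_mode n x = fourier_mode (n - 1) x"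
  by (simp add: fourier_mode_def exp_add[symmetric] algebra_simps)

lemma fourier_coeff_const:
  "fourier_coeff (\<lambda>_. 1) n = (if n = 0 then 1 else 0)"
proof (cases "n = 0")
  case False
  define w where "w = - (2 * of_real pi * \<i> * of_int n)"
  have w: "w \<noteq> 0" using False by (simp add: w_def)
  have "((\<lambda>x. exp (w * of_real x)) has_integral exp (w * of_real (1/2)) / w - exp (w * of_real (-1/2)) / w) {-1/2..1/2}"
  proof (rule fundamental_theorem_of_calculus)
    fix x :: real
    have "((\<lambda>z. exp (w * z) / w) has_field_derivative exp (w * of_real x)) (at (of_real x))"
      using w by (auto intro!: derivative_eq_intros)
    from has_vector_derivative_real_field[OF this]
    show "((\<lambda>x. exp (w * of_real x) / w) has_vector_derivative exp (w * of_real x)) (at x within {-1/2..1/2})"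
      by (simp add: o_def)
  qed auto
  moreover have "exp (w * of_real (1/2)) = exp (w * of_real (-1/2)) * exp w"
    by (simp add: exp_add[symmetric] algebra_simps)
  moreover have "exp w = 1"
    using exp_two_pi_i_eq_1_iff[of "- of_int n"] by (simp add: w_def)
  ultimately have "((\<lambda>x. exp (w * of_real x)) has_integral 0) {-1/2..1/2}" by simp
  thus ?thesis using False by (simp add: fourier_coeff_def fourier_mode_def w_def integral_unique mult_ac)
qed (simp add: fourier_coeff_def fourier_mode_def)

lemma sum_symmetric_telescope:
  fixes c h :: "int \<Rightarrow> 'a::comm_ring_1"
  assumes "\<And>n. c n = C * (if n = 0 then 1 else 0) + (h (n - 1) - h n)"
  shows "(\<Sum>n\<in>{- int N..int N}. c n) = C + (h (- int N - 1) - h (int N))"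
proof (induction N)
  case (Suc N)
  have "{- int (Suc N)..int (Suc N)} = insert (int N + 1) (insert (- int N - 1) {- int N..int N})" by auto
  thus ?case using Suc by (simp add: assms add.commute[of 1])
qed (simp add: assms)

text \<open>
  Chernoff's argument. Write \<open>F z = F 0 + (exp (2 \<pi> \<i> z) - 1) H z\<close>. Multiplication by the
  exponential shifts Fourier coefficients by one, so those of \<open>F - F 0\<close> are differences of
  consecutive coefficients of \<open>H\<close>: their symmetric partial sums telescope to two coefficients of
  \<open>H\<close> that tend to \<open>0\<close>.
\<close>
lemma fourier_series_at_0:
  assumes F: "F holomorphic_on ball (0::complex) 1"
  shows "(\<lambda>N. \<Sum>n\<in>{- int N..int N}. fourier_coeff F n) \<longlonglongrightarrow> F 0"
proof -
  obtain H where H: "H holomorphic_on ball 0 1"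
    and FH: "\<And>z. z \<in> ball 0 1 \<Longrightarrow> F z = F 0 + (exp (2 * of_real pi * \<i> * z) - 1) * H z"
    using fourier_difference_quotient[OF F] by blast
  obtain K where K: "\<And>n. norm (of_int n * fourier_coeff H n) \<le> K"
    using fourier_coeff_decay[OF H] by blast
  have coeff: "fourier_coeff F n = F 0 * (if n = 0 then 1 else 0) + (fourier_coeff H (n - 1) - fourier_coeff H n)" for n
  proof -
    have i: "(\<lambda>x. H (of_real x) * fourier_mode m x) integrable_on {-1/2..1/2}" for m
      by (intro integrable_continuous_interval continuous_intros continuous_on_segment H)
    have "fourier_coeff F n = integral {-1/2..1/2} (\<lambda>x. F (of_real x) * fourier_mode n x)"
      by (simp only: fourier_coeff_def)
    also have "\<dots> = integral {-1/2..1/2} (\<lambda>x. F 0 * (1 * fourier_mode n x) +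
        (H (of_real x) * fourier_mode (n - 1) x - H (of_real x) * fourier_mode n x))"
    proof (rule integral_cong)
      fix x :: real assume "x \<in> {-1/2..1/2}"
      from FH[OF segment_in_unit_ball[OF this]]
      show "F (of_real x) * fourier_mode n x = F 0 * (1 * fourier_mode n x) +
        (H (of_real x) * fourier_mode (n - 1) x - H (of_real x) * fourier_mode n x)"
        by (simp only: fourier_mode_shift[symmetric]) (simp add: ring_distribs)
    qed
    also have "\<dots> = F 0 * fourier_coeff (\<lambda>_. 1) n + (fourier_coeff H (n - 1) - fourier_coeff H n)"
      unfolding fourier_coeff_def
      by (intro integral_unique has_integral_add has_integral_diff has_integral_mult_right integrable_integral i
            integrable_continuous_interval continuous_intros)
    finally show ?thesis by (simp only: fourier_coeff_const)
  qed
  have partial: "(\<Sum>n\<in>{- int N..int N}. fourier_coeff F n) = F 0 + (fourier_coeff H (- int N - 1) - fourier_coeff H (int N))" for N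
    by (rule sum_symmetric_telescope[of "fourier_coeff F" "F 0" "fourier_coeff H", OF coeff])
  have decay: "norm (fourier_coeff H n) \<le> K / \<bar>of_int n\<bar>" if "n \<noteq> 0" for n
    using K[of n] that by (simp add: norm_mult field_simps)
  have "(\<lambda>N. fourier_coeff H (int N)) \<longlonglongrightarrow> 0"
  proof (rule Lim_null_comparison)
    show "\<forall>\<^sub>F N in sequentially. norm (fourier_coeff H (int N)) \<le> K / real N"
      using eventually_gt_at_top[of 0]
    proof eventually_elim
      case (elim N)
      thus ?case using decay[of "int N"] by simp
    qed
    show "(\<lambda>N. K / real N) \<longlonglongrightarrow> 0" by real_asymp
  qed
  moreover have "(\<lambda>N. fourier_coeff H (- int N - 1)) \<longlonglongrightarrow> 0"
  proof (rule Lim_null_comparison)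
    show "\<forall>\<^sub>F N in sequentially. norm (fourier_coeff H (- int N - 1)) \<le> K / (real N + 1)"
    proof (intro always_eventually allI)
      fix N show "norm (fourier_coeff H (- int N - 1)) \<le> K / (real N + 1)"
        using decay[of "- int N - 1"] by (simp add: abs_if add_ac)
    qed
    show "(\<lambda>N. K / (real N + 1)) \<longlonglongrightarrow> 0" by real_asymp
  qed
  ultimately have "(\<lambda>N. F 0 + (fourier_coeff H (- int N - 1) - fourier_coeff H (int N))) \<longlonglongrightarrow> F 0 + (0 - 0)"
    by (intro tendsto_intros)
  thus ?thesis by (simp only: partial) simp
qed

section \<open>The Gaussian integral with a complex linear term\<close>
definition gauss :: "complex \<Rightarrow> real \<Rightarrow> complex \<Rightarrow> complex" where
  "gauss b t z = exp (- (b * z) - of_real t * z\<^sup>2)"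

lemma has_bochner_integral_std_gaussian:
  "has_bochner_integral lborel (\<lambda>x. exp (\<i> * of_real (s * x) - of_real (x\<^sup>2 / 2)))
     (of_real (sqrt (2 * pi)) * exp (- of_real (s\<^sup>2 / 2)) :: complex)"
proof -
  interpret real_distribution std_normal_distribution by (rule real_dist_normal_dist)
  let ?g = "\<lambda>x. exp (\<i> * of_real (s * x)) :: complex"
  have "integrable std_normal_distribution ?g"
    by (rule integrable_iexp) auto
  moreover have "(LINT x|std_normal_distribution. ?g x) = exp (- of_real (s\<^sup>2 / 2))"
    using fun_cong[OF char_std_normal_distribution, of s]
    by (simp add: char_def exp_of_real[symmetric] del: of_real_power)
  ultimately have "has_bochner_integral lborel (\<lambda>x. std_normal_density x *\<^sub>R ?g x) (exp (- of_real (s\<^sup>2 / 2)))"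
    by (simp add: has_bochner_integral_iff integrable_density integral_density)
  from has_bochner_integral_mult_right[OF this, of "of_real (sqrt (2 * pi))"]
  have "has_bochner_integral lborel (\<lambda>x. of_real (sqrt (2 * pi)) * (std_normal_density x *\<^sub>R ?g x))
      (of_real (sqrt (2 * pi)) * exp (- of_real (s\<^sup>2 / 2)))" by simp
  moreover have "of_real (sqrt (2 * pi)) * (std_normal_density x *\<^sub>R ?g x) = exp (\<i> * of_real (s * x) - of_real (x\<^sup>2 / 2))" for x
  proof -
    have "std_normal_density x = exp (- (x\<^sup>2 / 2)) / sqrt (2 * pi)"
      by (simp add: std_normal_density_def)
    moreover have "exp (\<i> * of_real (s * x) - of_real (x\<^sup>2 / 2)) = ?g x * of_real (exp (- (x\<^sup>2 / 2)))"
      by (simp only: diff_conv_add_uminus exp_add of_real_minus exp_of_real[symmetric])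
    ultimately show ?thesis by (simp only: scaleR_conv_of_real of_real_divide) simp
  qed
  ultimately show ?thesis by simp
qed

lemma gauss_of_real:
  "gauss b t (of_real x) = exp (Complex (- (Re b * x) - t * x\<^sup>2) (- (Im b * x)))"
  unfolding gauss_def
  by (rule arg_cong[of _ _ exp], rule complex_eqI) (simp_all flip: of_real_power)

text \<open>
  Completing the square over the reals, \<open>x = m + u / sqrt (2 t)\<close> with \<open>m = - Re b / (2 t)\<close>, removes the
  real part of the linear term. The imaginary part turns into the phase of the characteristic function
  of the normal distribution, so no contour has to be moved.
\<close>
lemma has_bochner_integral_gauss:
  assumes t: "t > 0"
  shows "has_bochner_integral lborel (\<lambda>x. gauss b t (of_real x))
           (of_real (sqrt (pi / t)) * exp (b\<^sup>2 / (4 * of_real t)))"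
proof -
  define c where "c = sqrt (2 * t)"
  have c: "c > 0" "c\<^sup>2 = 2 * t" using t by (auto simp: c_def)
  define m where "m = - Re b / (2 * t)"
  define s where "s = - Im b / c"
  define A where "A = Complex ((Re b)\<^sup>2 / (4 * t)) (Re b * Im b / (2 * t))"
  have gauss_eq: "gauss b t (of_real (m + (1/c) * x)) = exp A * exp (\<i> * of_real (s * x) - of_real (x\<^sup>2 / 2))" for x
  proof -
    have 1: "t * (x / c)\<^sup>2 = x\<^sup>2 / 2" using t by (simp add: power_divide c(2))
    have 2: "- (Re b * (m + v)) - t * (m + v)\<^sup>2 = (Re b)\<^sup>2 / (4 * t) - t * v\<^sup>2" for v
      using t by (simp add: m_def field_simps power2_eq_square)
    have 3: "- (Im b * (m + x / c)) = Re b * Im b / (2 * t) + s * x"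
      by (simp add: m_def s_def ring_distribs)
    have "Complex (- (Re b * (m + (1/c) * x)) - t * (m + (1/c) * x)\<^sup>2) (- (Im b * (m + (1/c) * x)))
        = A + (\<i> * of_real (s * x) - of_real (x\<^sup>2 / 2))"
      using 1 2[of "x / c"] 3 by (intro complex_eqI) (simp_all add: A_def del: of_real_power of_real_mult of_real_divide)
    thus ?thesis unfolding gauss_of_real by (simp only: exp_add)
  qed
  have "has_bochner_integral lborel (\<lambda>x. gauss b t (of_real (m + (1/c) * x)))
      (exp A * (of_real (sqrt (2 * pi)) * exp (- of_real (s\<^sup>2 / 2))))"
    unfolding gauss_eq using has_bochner_integral_std_gaussian[of s] by (intro has_bochner_integral_mult_right) auto
  also have "exp A * (of_real (sqrt (2 * pi)) * exp (- of_real (s\<^sup>2 / 2)))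
      = (of_real (sqrt (pi / t)) * exp (b\<^sup>2 / (4 * of_real t))) /\<^sub>R \<bar>1 / c\<bar>"
  proof -
    have s2: "s\<^sup>2 / 2 = (Im b)\<^sup>2 / (4 * t)" by (simp add: s_def power_divide c(2))
    have "A + - of_real (s\<^sup>2 / 2) = Complex (((Re b)\<^sup>2 - (Im b)\<^sup>2) / (4 * t)) (Re b * Im b / (2 * t))"
      unfolding s2 A_def by (intro complex_eqI) (simp_all add: diff_divide_distrib del: of_real_power of_real_mult of_real_divide)
    also have "\<dots> = b\<^sup>2 / of_real (4 * t)"
      by (intro complex_eqI) (simp_all add: Re_divide_of_real Im_divide_of_real power2_eq_square del: of_real_mult)
    finally have "exp A * exp (- of_real (s\<^sup>2 / 2)) = exp (b\<^sup>2 / (4 * of_real t))"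
      by (simp add: exp_add[symmetric])
    moreover have "sqrt (2 * pi) = sqrt (pi / t) * c"
      using t by (simp add: c_def real_sqrt_mult[symmetric])
    ultimately show ?thesis using c(1)
      by (simp add: scaleR_conv_of_real mult_ac)
  qed
  finally show ?thesis
    using lborel_has_bochner_integral_real_affine_iff[of "1/c" "\<lambda>x. gauss b t (of_real x)" _ m] c(1) by simp
qed

section \<open>Poisson summation for bilateral theta series\<close>

text \<open>
  A bound that decays exponentially in \<open>norm z\<close>, uniformly on the strip \<open>\<bar>Im z\<bar> \<le> 1\<close>: the quadratic
  term beats \<open>norm b * norm z\<close> with \<open>norm z\<close> to spare. It serves as summable majorant in the Weierstrass
  test, on complex discs as well as on the real line.
\<close>
lemma norm_gauss_le:
  assumes t: "t > 0" and z: "\<bar>Im z\<bar> \<le> 1"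
  shows "norm (gauss b t z) \<le> exp ((norm b + 1)\<^sup>2 / (4 * t) + 2 * t) * exp (- norm z)"
proof -
  define R where "R = norm z"
  have "- Re (b * z) \<le> norm b * R"
    using abs_Re_le_cmod[of "b * z"] by (simp add: R_def norm_mult)
  moreover have "Re (z\<^sup>2) \<ge> R\<^sup>2 - 2"
  proof -
    have "(Im z)\<^sup>2 \<le> 1" using z by (simp add: abs_square_le_1)
    thus ?thesis using cmod_power2[of z] by (simp add: R_def power2_eq_square)
  qed
  hence "t * (R\<^sup>2 - 2) \<le> t * Re (z\<^sup>2)" using t by (intro mult_left_mono) auto
  moreover have "norm b * R - t * R\<^sup>2 \<le> (norm b + 1)\<^sup>2 / (4 * t) - R"
  proof -
    have "0 \<le> t * (R - (norm b + 1) / (2 * t))\<^sup>2" using t by simp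
    also have "\<dots> = t * R\<^sup>2 - (norm b + 1) * R + (norm b + 1)\<^sup>2 / (4 * t)"
      using t by (simp add: power2_eq_square field_simps)
    finally show ?thesis by (simp add: algebra_simps)
  qed
  ultimately have "Re (- (b * z) - of_real t * z\<^sup>2) \<le> (norm b + 1)\<^sup>2 / (4 * t) + 2 * t - R"
    by (simp add: algebra_simps)
  thus ?thesis by (simp add: gauss_def norm_exp_eq_Re exp_add[symmetric] R_def)
qed

text \<open>
  The sum over all integers is folded into a sum over \<^typ>\<open>nat\<close> by pairing \<open>k\<close> with \<open>- 1 - k\<close>, which is
  the reflection that relates the two halves of the series below. The variable \<open>z\<close> displaces the whole
  lattice; it is complex so that the displaced series is seen to be holomorphic.
\<close>
definition theta_term :: "complex \<Rightarrow> real \<Rightarrow> real \<Rightarrow> nat \<Rightarrow> complex \<Rightarrow> complex" where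
  "theta_term b t a k z = gauss b t (of_real (a + real k) + z) + gauss b t (of_real (a - 1 - real k) + z)"

definition theta :: "complex \<Rightarrow> real \<Rightarrow> real \<Rightarrow> complex" where
  "theta b t a = (\<Sum>k. theta_term b t a k 0)"

lemma summable_exp_minus: "summable (\<lambda>k. exp (- real k))"
  using summable_geometric[of "exp (-1::real)"] by (simp add: exp_of_nat_mult[symmetric])

lemma theta_term_bound:
  assumes t: "t > 0"
  obtains M where "summable M" and "\<And>k z. norm z < 1 \<Longrightarrow> norm (theta_term b t a k z) \<le> M k"
proof
  define K where "K = exp ((norm b + 1)\<^sup>2 / (4 * t) + 2 * t)"
  define M where "M k = 2 * K * exp (\<bar>a\<bar> + 2) * exp (- real k)" for k :: nat
  show "summable M" unfolding M_def[abs_def] by (intro summable_mult summable_exp_minus)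
  fix k :: nat and z :: complex assume z: "norm z < 1"
  have *: "norm (gauss b t (of_real u + z)) \<le> K * exp (\<bar>a\<bar> + 2) * exp (- real k)" if u: "\<bar>u\<bar> \<ge> real k - \<bar>a\<bar> - 1" for u
  proof -
    have "\<bar>Im (of_real u + z)\<bar> \<le> 1" using z abs_Im_le_cmod[of z] by simp
    from norm_gauss_le[OF t this, of b]
    have "norm (gauss b t (of_real u + z)) \<le> K * exp (- norm (of_real u + z))" by (simp add: K_def)
    also have "norm (of_real u + z) \<ge> \<bar>u\<bar> - norm z"
      using norm_diff_ineq[of "complex_of_real u" z] by simp
    hence "K * exp (- norm (of_real u + z)) \<le> K * exp (\<bar>a\<bar> + 2 - real k)"
      using u z by (intro mult_left_mono) (auto simp: K_def)
    finally show ?thesis by (simp add: exp_diff exp_minus field_simps)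
  qed
  have "norm (theta_term b t a k z) \<le> norm (gauss b t (of_real (a + real k) + z)) + norm (gauss b t (of_real (a - 1 - real k) + z))"
    unfolding theta_term_def by (rule norm_triangle_ineq)
  also have "\<dots> \<le> M k"
  proof -
    have "\<bar>a + real k\<bar> \<ge> real k - \<bar>a\<bar> - 1" "\<bar>a - 1 - real k\<bar> \<ge> real k - \<bar>a\<bar> - 1" by linarith+
    from add_mono[OF this[THEN *]] show ?thesis by (simp add: M_def mult_ac)
  qed
  finally show "norm (theta_term b t a k z) \<le> M k" .
qed

lemma theta_term_holomorphic [holomorphic_intros]: "theta_term b t a k holomorphic_on A"
  unfolding theta_term_def[abs_def] gauss_def by (intro holomorphic_intros)

lemma theta_holomorphic:
  assumes t: "t > 0"
  shows "(\<lambda>z. \<Sum>k. theta_term b t a k z) holomorphic_on ball 0 1"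
proof -
  obtain M where M: "summable M" "\<And>k z. norm z < 1 \<Longrightarrow> norm (theta_term b t a k z) \<le> M k"
    using theta_term_bound[OF t] by blast
  have ul: "uniform_limit (ball 0 1) (\<lambda>N z. \<Sum>k<N. theta_term b t a k z) (\<lambda>z. \<Sum>k. theta_term b t a k z) sequentially"
    using M by (intro Weierstrass_m_test[of _ _ M]) auto
  show ?thesis
  proof (rule holomorphic_uniform_sequence[where f = "\<lambda>N z. \<Sum>k<N. theta_term b t a k z"])
    fix x :: complex assume "x \<in> ball 0 1"
    then obtain d where "d > 0" "cball x d \<subseteq> ball 0 1"
      using open_contains_cball[of "ball (0::complex) 1"] by blast
    thus "\<exists>d>0. cball x d \<subseteq> ball 0 1 \<and> uniform_limit (cball x d) (\<lambda>N z. \<Sum>k<N. theta_term b t a k z)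
            (\<lambda>z. \<Sum>k. theta_term b t a k z) sequentially"
      using uniform_limit_on_subset[OF ul] by blast
  qed (auto intro!: holomorphic_intros)
qed

lemma fourier_mode_periodic:
  assumes "c \<in> \<int>" shows "fourier_mode n (x + c) = fourier_mode n x"
proof -
  obtain m where m: "c = of_int m" using assms by (auto elim: Ints_cases)
  have "fourier_mode n (x + c) = fourier_mode n x * exp (2 * of_real pi * \<i> * of_int (- n * m))"
    by (simp add: fourier_mode_def m exp_add[symmetric] algebra_simps)
  also have "exp (2 * of_real pi * \<i> * of_int (- n * m)) = 1"
    by (subst exp_two_pi_i_eq_1_iff) (rule Ints_of_int)
  finally show ?thesis by simp
qed

lemma continuous_gauss [continuous_intros]:
  "continuous_on A f \<Longrightarrow> continuous_on A (\<lambda>x. gauss b t (f x))"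
  unfolding gauss_def by (intro continuous_intros)

text \<open>
  Unfolding: the unit intervals around the integers \<open>- N, \<dots>, N - 1\<close> tile
  \<open>[- N - 1/2, N - 1/2]\<close>, and the Fourier mode does not see the integer translations.
\<close>
lemma theta_unfold_partial:
  fixes b :: complex and t a :: real
  defines "g \<equiv> (\<lambda>n u. gauss b t (of_real (a + u)) * fourier_mode n u)"
  shows "((\<lambda>x. \<Sum>k<N. theta_term b t a k (of_real x) * fourier_mode n x)
           has_integral integral {- real N - 1/2..real N - 1/2} (g n)) {-1/2..1/2}"
proof (induction N)
  case 0
  show ?case by simp
next
  case (Suc N)
  have int: "g n integrable_on {u..v}" for u v
    unfolding g_def by (intro integrable_continuous_interval continuous_intros)
  have 1: "((\<lambda>x. g n (x + real N)) has_integral integral {real N - 1/2..real N + 1/2} (g n)) {-1/2..1/2}"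
  proof -
    have ends: "real N - 1/2 - real N = -1/2" "real N + 1/2 - real N = 1/2" by simp_all
    show ?thesis
      using has_integral_shift_real_ivl[OF integrable_integral[OF int], of "real N" "real N - 1/2" "real N + 1/2"]
      by (simp only: ends)
  qed
  have 2: "((\<lambda>x. g n (x + (- 1 - real N))) has_integral integral {- real N - 3/2..- real N - 1/2} (g n)) {-1/2..1/2}"
  proof -
    have ends: "- real N - 3/2 - (- 1 - real N) = -1/2" "- real N - 1/2 - (- 1 - real N) = 1/2" by simp_all
    show ?thesis
      using has_integral_shift_real_ivl[OF integrable_integral[OF int], of "- 1 - real N" "- real N - 3/2" "- real N - 1/2"]
      by (simp only: ends)
  qed
  have eq: "theta_term b t a N (of_real x) * fourier_mode n x = g n (x + real N) + g n (x + (- 1 - real N))" for x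
  proof -
    have "fourier_mode n (x + (- 1 - real N)) = fourier_mode n x" "fourier_mode n (x + real N) = fourier_mode n x"
      by (rule fourier_mode_periodic; simp)+
    thus ?thesis by (simp only: g_def theta_term_def ring_distribs) (simp add: algebra_simps)
  qed
  have "integral {- real (Suc N) - 1/2..real (Suc N) - 1/2} (g n) =
      integral {- real N - 3/2..- real N - 1/2} (g n) + (integral {- real N - 1/2..real N - 1/2} (g n) + integral {real N - 1/2..real N + 1/2} (g n))"
    using Henstock_Kurzweil_Integration.integral_combine[OF _ _ int, of "- real N - 3/2" "- real N - 1/2" "real N + 1/2"]
      Henstock_Kurzweil_Integration.integral_combine[OF _ _ int, of "- real N - 1/2" "real N - 1/2" "real N + 1/2"]
    by (simp add: algebra_simps)
  thus ?case using has_integral_add[OF Suc has_integral_add[OF 1 2]] by (simp add: eq add_ac)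
qed

lemma integral_tendsto_lborel:
  fixes g :: "real \<Rightarrow> complex"
  assumes g: "has_bochner_integral lborel g I"
  shows "(\<lambda>N. integral {- real N - 1/2..real N - 1/2} g) \<longlonglongrightarrow> I"
proof -
  let ?S = "\<lambda>N. {- real N - 1/2..real N - 1/2}"
  have int: "integrable lborel g" and I: "integral\<^sup>L lborel g = I" using g by (auto simp: has_bochner_integral_iff)
  have "(\<lambda>N. (LINT x|lborel. indicator (?S N) x *\<^sub>R g x)) \<longlonglongrightarrow> (LINT x|lborel. g x)"
  proof (rule integral_dominated_convergence[where w = "\<lambda>x. norm (g x)"])
    show "AE x in lborel. (\<lambda>N. indicator (?S N) x *\<^sub>R g x) \<longlonglongrightarrow> g x"
    proof (rule AE_I2, rule tendsto_eventually)
      fix x :: real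
      show "\<forall>\<^sub>F N in sequentially. indicator (?S N) x *\<^sub>R g x = g x"
        using eventually_ge_at_top[of "nat \<lceil>\<bar>x\<bar> + 1\<rceil>"]
      proof eventually_elim
        case (elim N)
        hence "\<bar>x\<bar> + 1 \<le> real N" by linarith
        hence "x \<in> ?S N" by (simp add: abs_if split: if_splits)
        thus ?case by simp
      qed
    qed
  qed (use int in \<open>auto simp: indicator_def\<close>)
  moreover have "(LINT x|lborel. indicator (?S N) x *\<^sub>R g x) = integral (?S N) g" for N
    using set_borel_integral_eq_integral(2)[of "?S N" g] integrable_mult_indicator[OF _ int, of "?S N"]
    by (simp add: set_integrable_def set_lebesgue_integral_def)
  ultimately show ?thesis by (simp add: I)
qed

text \<open>
  The Fourier coefficients of the periodised Gaussian are values of its Fourier transform, and passing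
  to the frequency \<open>n\<close> means replacing \<open>b\<close> by \<open>b + 2 \<pi> \<i> n\<close>.
\<close>
lemma fourier_coeff_theta:
  assumes t: "t > 0"
  shows "fourier_coeff (\<lambda>z. \<Sum>k. theta_term b t a k z) n =
           of_real (sqrt (pi / t)) * exp (2 * of_real pi * \<i> * of_int n * of_real a) *
           exp ((b + 2 * of_real pi * \<i> * of_int n)\<^sup>2 / (4 * of_real t))" (is "_ = ?V")
proof -
  obtain M where M: "summable M" "\<And>k z. norm z < 1 \<Longrightarrow> norm (theta_term b t a k z) \<le> M k"
    using theta_term_bound[OF t] by blast
  define f where "f N x = (\<Sum>k<N. theta_term b t a k (of_real x) * fourier_mode n x)" for N and x :: real
  define F where "F x = (\<Sum>k. theta_term b t a k (of_real x)) * fourier_mode n x" for x :: real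
  have "uniform_limit {-1/2..1/2} f F sequentially"
  proof -
    have b: "norm (theta_term b t a k (of_real x)) \<le> M k" if "x \<in> {-1/2..1/2}" for k x
      using segment_in_unit_ball[OF that] by (intro M(2)) simp
    have "uniform_limit {-1/2..1/2} f (\<lambda>x. \<Sum>k. theta_term b t a k (of_real x) * fourier_mode n x) sequentially"
      unfolding f_def[abs_def] by (rule Weierstrass_m_test[OF _ M(1)]) (use b in \<open>simp add: norm_mult\<close>)
    moreover have "(\<Sum>k. theta_term b t a k (of_real x) * fourier_mode n x) = F x" if "x \<in> {-1/2..1/2}" for x
      unfolding F_def using b[OF that]
      by (intro suminf_mult2[symmetric] summable_comparison_test[OF _ M(1)]) auto
    ultimately show ?thesis by (subst uniform_limit_cong'[where g = f]) auto
  qed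
  moreover have "continuous_on {-1/2..1/2} (f N)" for N
    unfolding f_def theta_term_def by (intro continuous_intros)
  ultimately obtain I J where IJ: "\<And>N. (f N has_integral I N) {-1/2..1/2}" "(F has_integral J) {-1/2..1/2}" "I \<longlonglongrightarrow> J"
    by (rule uniform_limit_integral[OF _ _ trivial_limit_sequentially]) blast
  define g where "g u = gauss b t (of_real (a + u)) * fourier_mode n u" for u
  have "I N = integral {- real N - 1/2..real N - 1/2} g" for N
    using theta_unfold_partial[of b t a n N] IJ(1)[of N] unfolding f_def g_def by (rule has_integral_unique[symmetric])
  moreover have "has_bochner_integral lborel g ?V"
  proof -
    define b' where "b' = b + 2 * of_real pi * \<i> * of_int n"
    have "g u = exp (2 * of_real pi * \<i> * of_int n * of_real a) * gauss b' t (of_real (a + 1 * u))" for u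
      unfolding g_def gauss_def fourier_mode_def b'_def exp_add[symmetric]
      by (rule arg_cong[where f = exp]) (simp add: algebra_simps)
    moreover have "has_bochner_integral lborel (\<lambda>u. gauss b' t (of_real (a + 1 * u)))
        (of_real (sqrt (pi / t)) * exp (b'\<^sup>2 / (4 * of_real t)))"
      using has_bochner_integral_gauss[OF t, of b']
      by (subst (asm) lborel_has_bochner_integral_real_affine_iff[of 1 _ _ a]) auto
    from has_bochner_integral_mult_right[OF this, of "exp (2 * of_real pi * \<i> * of_int n * of_real a)"]
    have "has_bochner_integral lborel (\<lambda>u. exp (2 * of_real pi * \<i> * of_int n * of_real a) * gauss b' t (of_real (a + 1 * u))) ?V"
      by (simp add: b'_def mult_ac)
    ultimately show ?thesis by presburger
  qed
  ultimately have "I \<longlonglongrightarrow> ?V" using integral_tendsto_lborel by presburger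
  with IJ(3) have "J = ?V" by (rule LIMSEQ_unique)
  moreover have "fourier_coeff (\<lambda>z. \<Sum>k. theta_term b t a k z) n = J"
    unfolding fourier_coeff_def using integral_unique[OF IJ(2)] unfolding F_def .
  ultimately show ?thesis by simp
qed

lemma theta_poisson:
  assumes t: "t > 0"
  shows "(\<lambda>N. \<Sum>n\<in>{- int N..int N}. of_real (sqrt (pi / t)) *
            exp (2 * of_real pi * \<i> * of_int n * of_real a) *
            exp ((b + 2 * of_real pi * \<i> * of_int n)\<^sup>2 / (4 * of_real t))) \<longlonglongrightarrow> theta b t a"
  using fourier_series_at_0[OF theta_holomorphic[OF t, of b a]]
  unfolding fourier_coeff_theta[OF t] theta_def .

section \<open>Partial theta functions as the parameter tends to zero\<close>
definition partial_theta :: "complex \<Rightarrow> real \<Rightarrow> real \<Rightarrow> complex" where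
  "partial_theta b t a = (\<Sum>k. gauss b t (of_real (a + real k)))"

lemma gauss_uminus: "gauss b t (- z) = gauss (- b) t z"
  by (simp add: gauss_def)

lemma summable_gauss:
  assumes t: "t > 0"
  shows "summable (\<lambda>k. gauss b t (of_real (a + real k)))"
proof (rule summable_comparison_test)
  define K where "K = exp ((norm b + 1)\<^sup>2 / (4 * t) + 2 * t)"
  show "summable (\<lambda>k. K * exp \<bar>a\<bar> * exp (- real k))"
    by (intro summable_mult summable_exp_minus)
  have "norm (gauss b t (of_real (a + real k))) \<le> K * exp \<bar>a\<bar> * exp (- real k)" for k
  proof -
    have "norm (gauss b t (of_real (a + real k))) \<le> K * exp (- norm (complex_of_real (a + real k)))"
      unfolding K_def by (rule norm_gauss_le[OF t]) simp
    also have "\<dots> \<le> K * exp (\<bar>a\<bar> - real k)"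
      unfolding norm_of_real by (intro mult_left_mono) (auto simp: K_def)
    finally show ?thesis by (simp add: exp_diff exp_minus field_simps)
  qed
  thus "\<exists>N. \<forall>k\<ge>N. norm (gauss b t (of_real (a + real k))) \<le> K * exp \<bar>a\<bar> * exp (- real k)"
    by blast
qed

text \<open>
  The negative half of the bilateral series is again a partial theta function, with \<open>b\<close> replaced by
  \<open>- b\<close>. This brings the case \<open>Re b < 0\<close> back to the convergent case, at the price of the bilateral series.
\<close>
lemma theta_split:
  assumes t: "t > 0"
  shows "theta b t a = partial_theta b t a + partial_theta (- b) t (1 - a)"
proof -
  have "theta_term b t a k 0 = gauss b t (of_real (a + real k)) + gauss (- b) t (of_real (1 - a + real k))" for k
    using gauss_uminus[of b t "of_real (1 - a + real k)"] by (simp add: theta_term_def algebra_simps)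
  thus ?thesis
    unfolding theta_def partial_theta_def
    by (simp only: suminf_add[OF summable_gauss[OF t] summable_gauss[OF t]])
qed

text \<open>
  For \<open>Re b > 0\<close> the series at \<open>t = 0\<close> is a convergent geometric series, and the moduli of its terms
  dominate those for \<open>t > 0\<close>.
\<close>
lemma partial_theta_tendsto:
  assumes b: "Re b > 0"
  shows "((\<lambda>t. partial_theta b t a) \<longlongrightarrow> exp (- (b * of_real a)) / (1 - exp (- b))) (at_right 0)"
proof -
  define L where "L k = exp (- (b * of_real (a + real k)))" for k
  define M where "M k = exp (- (Re b * (a + real k)))" for k
  have r: "norm (exp (- b)) < 1" using b by (simp add: norm_exp_eq_Re)
  have L: "L k = exp (- (b * of_real a)) * exp (- b) ^ k" for k
    by (simp add: L_def exp_of_nat_mult[symmetric] exp_add[symmetric] algebra_simps)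
  have M: "M k = exp (- (Re b * a)) * exp (- Re b) ^ k" for k
    by (simp add: M_def exp_of_nat_mult[symmetric] exp_add[symmetric] algebra_simps)
  have "eventually (\<lambda>t. summable (\<lambda>k. norm (gauss b t (of_real (a + real k))))) (at_right 0) \<and>
      summable (\<lambda>k. norm (L k)) \<and> ((\<lambda>t. \<Sum>k. gauss b t (of_real (a + real k))) \<longlongrightarrow> suminf L) (at_right (0::real))"
  proof (rule tannerys_theorem)
    show "((\<lambda>t. gauss b t (of_real (a + real k))) \<longlongrightarrow> L k) (at_right 0)" for k
      unfolding gauss_def L_def by (auto intro!: tendsto_eq_intros)
    have "eventually (\<lambda>t::real. t > 0) (at_right 0)" by (simp add: eventually_at_right_less)
    hence "eventually (\<lambda>(k::nat, t::real). t > 0) (at_top \<times>\<^sub>F at_right 0)"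
      by (subst eventually_prod2) auto
    thus "eventually (\<lambda>(k, t). norm (gauss b t (of_real (a + real k))) \<le> M k) (at_top \<times>\<^sub>F at_right 0)"
    proof eventually_elim
      case (elim kt)
      have "norm (gauss b t (of_real (a + real k))) \<le> M k" if "t > 0" for k t
        unfolding gauss_of_real norm_exp_eq_Re M_def using that by simp
      thus ?case using elim by auto
    qed
    show "summable M" unfolding M[abs_def] using b by (intro summable_mult summable_geometric) auto
  qed auto
  moreover have "suminf L = exp (- (b * of_real a)) / (1 - exp (- b))"
    unfolding L[abs_def] using r by (simp add: suminf_mult suminf_geometric summable_geometric)
  ultimately show ?thesis by (simp add: partial_theta_def)
qed

lemma sum_power_abs_le:
  fixes r :: real
  assumes "0 \<le> r" "r < 1"
  shows "(\<Sum>n\<in>{- int N..int N}. r ^ nat \<bar>n\<bar>) \<le> 2 / (1 - r)"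
proof -
  have "(\<Sum>n\<in>{- int N..int N}. r ^ nat \<bar>n\<bar>) \<le> 2 * (\<Sum>k\<le>N. r ^ k)"
  proof (induction N)
    case (Suc N)
    have "{- int (Suc N)..int (Suc N)} = insert (int N + 1) (insert (- int N - 1) {- int N..int N})" by auto
    moreover have "nat \<bar>int N + 1\<bar> = Suc N" "nat \<bar>- int N - 1\<bar> = Suc N" by auto
    ultimately show ?case using Suc by simp
  qed simp
  also have "(\<Sum>k\<le>N. r ^ k) \<le> (\<Sum>k. r ^ k)"
    using assms by (intro sum_le_suminf summable_geometric) auto
  also have "\<dots> = 1 / (1 - r)" using assms by (intro suminf_geometric) auto
  finally show ?thesis by simp
qed

text \<open>
  Real part of the Poisson exponents: once \<open>\<bar>\<rho>\<bar> < m\<close>, the frequencies at distance at least \<open>m\<close> give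
  \<open>\<rho>\<^sup>2 - (\<beta> + 2 \<pi> n)\<^sup>2\<close> a bound that is both uniformly negative and linear in \<open>\<bar>n\<bar>\<close>. The former makes the
  sum over \<open>n\<close> exponentially small in \<open>1 / t\<close>, the latter makes it converge.
\<close>
lemma quadratic_gap:
  fixes \<beta> \<rho> m :: real
  assumes m: "\<bar>\<rho>\<bar> < m"
  obtains \<delta> where "\<delta> > 0"
    and "\<And>n::int. m \<le> \<bar>\<beta> + 2 * pi * n\<bar> \<Longrightarrow> \<rho>\<^sup>2 + \<delta> * (1 + \<bar>real_of_int n\<bar>) \<le> (\<beta> + 2 * pi * n)\<^sup>2"
proof
  \<comment> \<open>For \<open>X = (\<beta> + 2 \<pi> n)\<^sup>2 \<ge> m\<^sup>2\<close> one has \<open>\<kappa> X \<le> X - \<rho>\<^sup>2\<close> and \<open>1 + \<bar>n\<bar> \<le> C X\<close>.\<close>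
  define \<kappa> where "\<kappa> = 1 - \<rho>\<^sup>2 / m\<^sup>2"
  define C where "C = 2 + (1 + 2 * \<beta>\<^sup>2) / m\<^sup>2"
  have m0: "m > 0" using m by linarith
  have "\<rho>\<^sup>2 < m\<^sup>2" using m m0 by (metis abs_le_square_iff abs_of_pos not_less)
  hence \<kappa>: "\<kappa> > 0" using m0 by (simp add: \<kappa>_def)
  have C: "C > 0" by (simp add: C_def add_pos_nonneg)
  show "\<kappa> / C > 0" using \<kappa> C by simp
  fix n :: int
  assume n: "m \<le> \<bar>\<beta> + 2 * pi * n\<bar>"
  define X where "X = (\<beta> + 2 * pi * n)\<^sup>2"
  have X: "m\<^sup>2 \<le> X" using n m0 by (simp add: X_def abs_le_square_iff[symmetric])
  have "real_of_int \<bar>n\<bar> \<le> real_of_int (n\<^sup>2)"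
  proof -
    have "\<bar>n\<bar> * 1 \<le> \<bar>n\<bar> * \<bar>n\<bar>" by (cases "n = 0") (use mult_left_mono[of 1 "\<bar>n\<bar>" "\<bar>n\<bar>"] in auto)
    thus ?thesis by (simp add: power2_eq_square flip: abs_mult of_int_mult) 
  qed
  also have "\<dots> \<le> (2 * pi * n)\<^sup>2"
  proof -
    have "1 * (real_of_int n)\<^sup>2 \<le> (2 * pi)\<^sup>2 * (real_of_int n)\<^sup>2"
      using pi_gt3 by (intro mult_right_mono one_le_power) auto
    thus ?thesis by (simp add: power_mult_distrib)
  qed
  also have "\<dots> = ((\<beta> + 2 * pi * n) - \<beta>)\<^sup>2" by simp
  also have "\<dots> \<le> 2 * X + 2 * \<beta>\<^sup>2"
  proof -
    have "(x - \<beta>)\<^sup>2 \<le> 2 * x\<^sup>2 + 2 * \<beta>\<^sup>2" for x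
      using zero_le_power2[of "x + \<beta>"] by (simp add: power2_sum power2_diff)
    thus ?thesis unfolding X_def .
  qed
  finally have "1 + \<bar>real_of_int n\<bar> \<le> 2 * X + (1 + 2 * \<beta>\<^sup>2)" by simp
  also have "\<dots> \<le> C * X"
  proof -
    have "(1 + 2 * \<beta>\<^sup>2) / m\<^sup>2 * m\<^sup>2 \<le> (1 + 2 * \<beta>\<^sup>2) / m\<^sup>2 * X"
      using X by (intro mult_left_mono) auto
    moreover have "(1 + 2 * \<beta>\<^sup>2) / m\<^sup>2 * m\<^sup>2 = 1 + 2 * \<beta>\<^sup>2" using m0 by simp
    ultimately show ?thesis unfolding C_def distrib_right by linarith
  qed
  finally have "\<kappa> / C * (1 + \<bar>real_of_int n\<bar>) \<le> \<kappa> / C * (C * X)"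
    using \<kappa> C by (intro mult_left_mono) auto
  also have "\<dots> = \<kappa> * X" using C by simp
  also have "\<dots> = X - \<rho>\<^sup>2 * (X / m\<^sup>2)" by (simp add: \<kappa>_def algebra_simps)
  also have "\<dots> \<le> X - \<rho>\<^sup>2 * 1"
    using X m0 by (intro diff_left_mono mult_left_mono) auto
  finally show "\<rho>\<^sup>2 + \<kappa> / C * (1 + \<bar>real_of_int n\<bar>) \<le> (\<beta> + 2 * pi * n)\<^sup>2" by (simp add: X_def)
qed

text \<open>
  Each of the two series may grow like \<open>exp (const / t)\<close>. In the Poisson-transformed difference the
  frequency \<open>n\<close> carries the factor \<open>exp (2 \<pi> \<i> n a1) - exp (2 \<pi> \<i> n a2)\<close>. Where it vanishes, the size of
  the Gaussian factor is irrelevant; at all other frequencies the gap makes the Gaussian factor small.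
\<close>
lemma theta_diff_tendsto_0:
  assumes gap: "\<And>n. exp (2 * of_real pi * \<i> * of_int n * of_real a1) \<noteq> exp (2 * of_real pi * \<i> * of_int n * of_real a2)
                  \<Longrightarrow> m \<le> \<bar>Im b + 2 * pi * of_int n\<bar>"
    and m: "\<bar>Re b\<bar> < m"
  shows "((\<lambda>t. theta b t a1 - theta b t a2) \<longlongrightarrow> 0) (at_right 0)"
proof -
  obtain \<delta> where \<delta>: "\<delta> > 0"
    "\<And>n::int. m \<le> \<bar>Im b + 2 * pi * n\<bar> \<Longrightarrow> (Re b)\<^sup>2 + \<delta> * (1 + \<bar>n\<bar>) \<le> (Im b + 2 * pi * n)\<^sup>2"
    using quadratic_gap[OF m, of "Im b"] by blast
  define r where "r = exp (- (\<delta> / 4))"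
  have r: "0 \<le> r" "r < 1" using \<delta> by (auto simp: r_def)
  define e where "e n a = exp (2 * of_real pi * \<i> * of_int n * of_real a)" for n :: int and a :: real
  have ne: "norm (e n a) = 1" for n a by (simp add: e_def norm_exp_eq_Re)
  have bound: "norm (theta b t a1 - theta b t a2) \<le> 2 * sqrt (pi / t) * exp (- (\<delta> / (4 * t))) * (2 / (1 - r))"
    if t: "0 < t" "t < 1" for t
  proof (rule LIMSEQ_le_const2)
    define G where "G n = of_real (sqrt (pi / t)) * exp ((b + 2 * of_real pi * \<i> * of_int n)\<^sup>2 / (4 * of_real t))" for n :: int
    have th: "(\<lambda>N. \<Sum>n\<in>{- int N..int N}. G n * e n a) \<longlonglongrightarrow> theta b t a" for a
      using theta_poisson[OF t(1), of a b] by (simp add: G_def e_def mult_ac)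
    show "(\<lambda>N. norm (\<Sum>n\<in>{- int N..int N}. G n * (e n a1 - e n a2))) \<longlonglongrightarrow> norm (theta b t a1 - theta b t a2)"
      using tendsto_norm[OF tendsto_diff[OF th[of a1] th[of a2]]] by (simp add: sum_subtractf right_diff_distrib)
    have summand: "norm (G n * (e n a1 - e n a2)) \<le> 2 * sqrt (pi / t) * exp (- (\<delta> / (4 * t))) * r ^ nat \<bar>n\<bar>" for n
    proof (cases "e n a1 = e n a2")
      case False
      have "norm (e n a1 - e n a2) \<le> 2"
        using norm_triangle_ineq4[of "e n a1" "e n a2"] by (simp add: ne)
      moreover have "norm (G n) \<le> sqrt (pi / t) * (exp (- (\<delta> / (4 * t))) * r ^ nat \<bar>n\<bar>)"
      proof -
        have "Re ((b + 2 * of_real pi * \<i> * of_int n)\<^sup>2) = (Re b)\<^sup>2 - (Im b + 2 * pi * n)\<^sup>2"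
          by (simp add: power2_eq_square)
        also have "\<dots> \<le> - (\<delta> * (1 + \<bar>n\<bar>))"
          using \<delta>(2)[OF gap[OF False[unfolded e_def]]] by simp
        finally have "Re ((b + 2 * of_real pi * \<i> * of_int n)\<^sup>2) / (4 * t) \<le> - (\<delta> * (1 + \<bar>n\<bar>)) / (4 * t)"
          using t by (intro divide_right_mono) auto
        also have "\<dots> = - (\<delta> / (4 * t)) + - (\<delta> * \<bar>n\<bar> / (4 * t))"
          by (simp add: ring_distribs add_divide_distrib diff_divide_distrib)
        also have "\<delta> * \<bar>n\<bar> / 4 \<le> \<delta> * \<bar>n\<bar> / (4 * t)"
          using t \<delta> by (intro divide_left_mono) auto
        hence "- (\<delta> / (4 * t)) + - (\<delta> * \<bar>n\<bar> / (4 * t)) \<le> - (\<delta> / (4 * t)) + nat \<bar>n\<bar> * - (\<delta> / 4)"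
          by (simp add: mult.commute)
        finally have "exp (Re ((b + 2 * of_real pi * \<i> * of_int n)\<^sup>2) / (4 * t)) \<le> exp (- (\<delta> / (4 * t)) + nat \<bar>n\<bar> * - (\<delta> / 4))"
          by (simp only: exp_le_cancel_iff)
        also have "\<dots> = exp (- (\<delta> / (4 * t))) * r ^ nat \<bar>n\<bar>"
          by (simp only: r_def exp_add exp_of_nat_mult)
        finally have *: "exp (Re ((b + 2 * of_real pi * \<i> * of_int n)\<^sup>2) / (4 * t)) \<le> exp (- (\<delta> / (4 * t))) * r ^ nat \<bar>n\<bar>" .
        have "norm (G n) = sqrt (pi / t) * exp (Re ((b + 2 * of_real pi * \<i> * of_int n)\<^sup>2 / of_real (4 * t)))"
          using t by (simp add: G_def norm_mult norm_exp_eq_Re)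
        also have "\<dots> = sqrt (pi / t) * exp (Re ((b + 2 * of_real pi * \<i> * of_int n)\<^sup>2) / (4 * t))"
          by (simp only: Re_divide_of_real)
        also have "\<dots> \<le> sqrt (pi / t) * (exp (- (\<delta> / (4 * t))) * r ^ nat \<bar>n\<bar>)"
          using * t by (intro mult_left_mono) auto
        finally show ?thesis .
      qed
      ultimately have "norm (G n) * norm (e n a1 - e n a2) \<le> sqrt (pi / t) * (exp (- (\<delta> / (4 * t))) * r ^ nat \<bar>n\<bar>) * 2"
        by (intro mult_mono) (use t r in auto)
      thus ?thesis by (simp add: norm_mult mult_ac)
    qed (use t r in auto)
    have "norm (\<Sum>n\<in>{- int N..int N}. G n * (e n a1 - e n a2)) \<le> 2 * sqrt (pi / t) * exp (- (\<delta> / (4 * t))) * (2 / (1 - r))" for N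
    proof -
      have "norm (\<Sum>n\<in>{- int N..int N}. G n * (e n a1 - e n a2))
          \<le> (\<Sum>n\<in>{- int N..int N}. 2 * sqrt (pi / t) * exp (- (\<delta> / (4 * t))) * r ^ nat \<bar>n\<bar>)"
        by (intro sum_norm_le summand)
      also have "\<dots> = 2 * sqrt (pi / t) * exp (- (\<delta> / (4 * t))) * (\<Sum>n\<in>{- int N..int N}. r ^ nat \<bar>n\<bar>)"
        by (rule sum_distrib_left[symmetric])
      also have "\<dots> \<le> 2 * sqrt (pi / t) * exp (- (\<delta> / (4 * t))) * (2 / (1 - r))"
        using t by (intro mult_left_mono sum_power_abs_le r) auto
      finally show ?thesis .
    qed
    thus "\<exists>N0. \<forall>N\<ge>N0. norm (\<Sum>n\<in>{- int N..int N}. G n * (e n a1 - e n a2)) \<le> 2 * sqrt (pi / t) * exp (- (\<delta> / (4 * t))) * (2 / (1 - r))"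
      by blast
  qed
  show ?thesis
  proof (rule Lim_null_comparison)
    have "eventually (\<lambda>t::real. 0 < t \<and> t < 1) (at_right 0)"
      unfolding eventually_at_right_field by (rule exI[of _ 1]) auto
    thus "eventually (\<lambda>t. norm (theta b t a1 - theta b t a2) \<le> 2 * sqrt (pi / t) * exp (- (\<delta> / (4 * t))) * (2 / (1 - r))) (at_right 0)"
      by eventually_elim (use bound in auto)
    have "((\<lambda>t. 2 * sqrt (pi / t) * exp (- (\<delta> / (4 * t)))) \<longlongrightarrow> 0) (at_right 0)"
      using \<delta>(1) pi_gt_zero by real_asymp
    thus "((\<lambda>t. 2 * sqrt (pi / t) * exp (- (\<delta> / (4 * t))) * (2 / (1 - r))) \<longlongrightarrow> 0) (at_right 0)"
      by (rule tendsto_mult_left_zero)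
  qed
qed

text \<open>
  The limit is the value of the geometric series in both half planes. For \<open>Re b < 0\<close> that series diverges,
  but the reflected one converges, and minus its sum is the same rational function of \<open>exp (- b)\<close>
  (formally, the geometric series over all integers is \<open>0\<close>).
\<close>
lemma partial_theta_diff_tendsto:
  assumes b: "Re b \<noteq> 0"
    and gap: "Re b < 0 \<Longrightarrow> \<exists>m > \<bar>Re b\<bar>. \<forall>n.
      exp (2 * of_real pi * \<i> * of_int n * of_real a1) \<noteq> exp (2 * of_real pi * \<i> * of_int n * of_real a2)
        \<longrightarrow> m \<le> \<bar>Im b + 2 * pi * of_int n\<bar>"
  shows "((\<lambda>t. partial_theta b t a1 - partial_theta b t a2) \<longlongrightarrow>
           (exp (- (b * of_real a1)) - exp (- (b * of_real a2))) / (1 - exp (- b))) (at_right 0)"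
proof (cases "Re b > 0")
  case True
  thus ?thesis
    unfolding diff_divide_distrib by (intro tendsto_diff partial_theta_tendsto)
next
  case False
  hence neg: "Re b < 0" using b by simp
  have "norm (exp b) < 1" using neg by (simp add: norm_exp_eq_Re)
  hence "exp b \<noteq> 1" by (metis norm_one less_irrefl)
  hence nz: "1 - exp b \<noteq> 0" by simp
  have refl: "- (exp (- (- b * of_real (1 - a))) / (1 - exp (- (- b)))) = exp (- (b * of_real a)) / (1 - exp (- b))" for a
  proof -
    have "exp (- (- b * of_real (1 - a))) = exp b * exp (- (b * of_real a))"
      by (simp add: exp_add[symmetric] algebra_simps)
    thus ?thesis using nz by (simp add: exp_minus[of b] divide_simps) (simp add: algebra_simps)
  qed
  have "((\<lambda>t. theta b t a1 - theta b t a2) \<longlongrightarrow> 0) (at_right 0)"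
    using gap[OF neg] theta_diff_tendsto_0 by blast
  moreover have "((\<lambda>t. - partial_theta (- b) t (1 - a)) \<longlongrightarrow> exp (- (b * of_real a)) / (1 - exp (- b))) (at_right 0)" for a
    unfolding refl[symmetric] using neg by (intro tendsto_minus partial_theta_tendsto) auto
  ultimately have "((\<lambda>t. (theta b t a1 - theta b t a2) + (- partial_theta (- b) t (1 - a1) - - partial_theta (- b) t (1 - a2)))
      \<longlongrightarrow> 0 + (exp (- (b * of_real a1)) / (1 - exp (- b)) - exp (- (b * of_real a2)) / (1 - exp (- b)))) (at_right 0)"
    by (intro tendsto_add tendsto_diff)
  moreover have "eventually (\<lambda>t. (theta b t a1 - theta b t a2) + (- partial_theta (- b) t (1 - a1) - - partial_theta (- b) t (1 - a2))
      = partial_theta b t a1 - partial_theta b t a2) (at_right 0)"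
    using eventually_at_right_less[of "0::real"] by eventually_elim (simp add: theta_split)
  ultimately show ?thesis
    unfolding diff_divide_distrib by (simp only: tendsto_cong add_0_left)
qed

section \<open>Characters of the singlet modules\<close>

text \<open>
  Needed for \<open>\<eta>\<close> to cancel in the quotient of characters.
\<close>
lemma dedekind_eta_nonzero:
  assumes y: "y > 0"
  shows "dedekind_eta (\<i> * of_real y) \<noteq> 0"
proof -
  define x where "x = exp (- (2 * pi * y))"
  have x: "0 < x" "x < 1" using y by (auto simp: x_def)
  have q: "qpow (\<i> * of_real y) (of_nat (Suc n)) = of_real (x ^ Suc n)" for n
  proof -
    have "2 * of_real pi * \<i> * (\<i> * of_real y) * of_nat (Suc n) = complex_of_real (real (Suc n) * - (2 * pi * y))"
      by (simp add: algebra_simps)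
    thus ?thesis unfolding qpow_def x_def by (simp only: exp_of_real exp_of_nat_mult)
  qed
  have "summable (\<lambda>n. x ^ Suc n)"
    using x by (simp add: summable_geometric)
  hence "convergent_prod (\<lambda>n. 1 - qpow (\<i> * of_real y) (of_nat (Suc n)))"
    unfolding q using x
    by (intro abs_convergent_prod_imp_convergent_prod summable_imp_abs_convergent_prod)
       (simp add: norm_mult norm_power)
  moreover have "1 - qpow (\<i> * of_real y) (of_nat (Suc n)) \<noteq> 0" for n
  proof -
    have "x ^ Suc n < 1" using x by (intro power_Suc_less_one) auto
    thus ?thesis unfolding q by (metis of_real_1 of_real_eq_iff less_irrefl right_minus_eq)
  qed
  ultimately have "(\<Prod>n. 1 - qpow (\<i> * of_real y) (of_nat (Suc n))) \<noteq> 0"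
    by (rule prodinf_nonzero)
  thus ?thesis by (simp add: dedekind_eta_def qpow_def)
qed

lemma has_qdimI:
  assumes X: "\<And>y. y > 0 \<Longrightarrow> reg_ch p \<epsilon> X (\<i> * of_real y) = f y / dedekind_eta (\<i> * of_real y)"
    and vac: "\<And>y. y > 0 \<Longrightarrow> reg_ch p \<epsilon> vacuum (\<i> * of_real y) = g y / dedekind_eta (\<i> * of_real y)"
    and f: "(f \<longlongrightarrow> A) (at_right 0)" and g: "(g \<longlongrightarrow> C) (at_right 0)" and C: "C \<noteq> 0"
  shows "has_qdim p \<epsilon> X (A / C)"
  unfolding has_qdim_def
proof (rule Lim_transform_eventually)
  show "((\<lambda>y. f y / g y) \<longlongrightarrow> A / C) (at_right 0)" by (intro tendsto_divide f g C)
  show "eventually (\<lambda>y. f y / g y = reg_ch p \<epsilon> X (\<i> * of_real y) / reg_ch p \<epsilon> vacuum (\<i> * of_real y)) (at_right 0)"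
    using eventually_at_right_less[of "0::real"]
  proof eventually_elim
    case (elim y)
    thus ?case unfolding X[OF elim] vac[OF elim] by (simp add: dedekind_eta_nonzero)
  qed
qed

text \<open>
  The coefficient \<open>b\<close> of the linear term when the summands of the characters of the \<open>M\<^sub>r\<^sub>,\<^sub>s\<close> are
  written as values of \<^const>\<open>gauss\<close>; then \<open>t = 2 \<pi> p y\<close>.
\<close>
definition charge :: "nat \<Rightarrow> complex \<Rightarrow> complex" where
  "charge p \<epsilon> = 2 * of_real pi * \<epsilon> * of_real (sqrt (2 * real p))"

lemma reg_ch_Irr:
  assumes p: "p > 0" and y: "y > 0"
  shows "reg_ch p \<epsilon> (Irr r s) (\<i> * of_real y) =
    (partial_theta (charge p \<epsilon>) (2 * pi * real p * y) ((2 - real_of_int r) / 2 - real s / (2 * real p)) -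
     partial_theta (charge p \<epsilon>) (2 * pi * real p * y) ((2 - real_of_int r) / 2 + real s / (2 * real p)))
      / dedekind_eta (\<i> * of_real y)"
proof -
  have t: "2 * pi * real p * y > 0" using p y by simp
  have *: "exp (- 2 * of_real pi * \<epsilon> * of_real (sqrt (2 * real p)) * of_real u) * qpow (\<i> * of_real y) (of_nat p * (of_real u)\<^sup>2)
      = gauss (charge p \<epsilon>) (2 * pi * real p * y) (of_real u)" for u
    unfolding qpow_def gauss_def exp_add[symmetric] charge_def
    by (rule arg_cong[where f = exp]) (simp add: algebra_simps)
  have u: "u_minus p r s k = ((2 - real_of_int r) / 2 - real s / (2 * real p)) + real k"
          "u_plus p r s k = ((2 - real_of_int r) / 2 + real s / (2 * real p)) + real k" for k
    by (simp_all add: u_minus_def u_plus_def)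
  show ?thesis
    unfolding reg_ch.simps * u partial_theta_def suminf_diff[OF summable_gauss[OF t] summable_gauss[OF t]]
    by simp
qed

lemma filterlim_mult_at_right_0:
  assumes "c > (0::real)" shows "filterlim (\<lambda>y. c * y) (at_right 0) (at_right 0)"
  unfolding filterlim_at
  using assms by (auto intro!: tendsto_eq_intros eventually_mono[OF eventually_at_right_less])

text \<open>
  The hypothesis on \<open>Re \<epsilon>\<close>, scaled by \<open>2 \<pi> sqrt (2 p)\<close>, is the gap condition for the frequencies that
  are not multiples of \<open>p\<close>. The frequency \<open>n\<close> corresponds to the integer \<open>- n\<close> in the definition of
  \<^const>\<open>B\<close>, whose index set is symmetric.
\<close>
lemma charge_gap:
  assumes p: "p \<ge> 2" and \<epsilon>: "Re \<epsilon> > B p \<epsilon>" and neg: "Re \<epsilon> < 0"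
  shows "\<exists>m > \<bar>Re (charge p \<epsilon>)\<bar>. \<forall>n. \<not> int p dvd n \<longrightarrow> m \<le> \<bar>Im (charge p \<epsilon>) + 2 * pi * of_int n\<bar>"
proof -
  define c where "c = sqrt (2 * real p)"
  have c: "c > 0" using p by (simp add: c_def)
  obtain k where k: "B p \<epsilon> = - \<bar>real_of_int k / c - Im \<epsilon>\<bar>"
    and min: "\<And>n. \<not> int p dvd n \<Longrightarrow> \<bar>real_of_int k / c - Im \<epsilon>\<bar> \<le> \<bar>real_of_int n / c - Im \<epsilon>\<bar>"
    unfolding c_def using B_attained[OF p, of \<epsilon>] by metis
  have "\<bar>Re (charge p \<epsilon>)\<bar> = 2 * pi * c * - Re \<epsilon>"
    using neg c by (simp add: charge_def c_def abs_mult)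
  also have "\<dots> < 2 * pi * c * \<bar>real_of_int k / c - Im \<epsilon>\<bar>"
    using k \<epsilon> c by (intro mult_strict_left_mono) auto
  finally have "\<bar>Re (charge p \<epsilon>)\<bar> < 2 * pi * c * \<bar>real_of_int k / c - Im \<epsilon>\<bar>" .
  moreover have "2 * pi * c * \<bar>real_of_int k / c - Im \<epsilon>\<bar> \<le> \<bar>Im (charge p \<epsilon>) + 2 * pi * of_int n\<bar>"
    if n: "\<not> int p dvd n" for n
  proof -
  have "2 * pi * c * \<bar>real_of_int k / c - Im \<epsilon>\<bar> \<le> 2 * pi * c * \<bar>real_of_int (- n) / c - Im \<epsilon>\<bar>"
    using c n by (intro mult_left_mono min) auto
  also have "\<dots> = \<bar>2 * pi * c * (real_of_int (- n) / c - Im \<epsilon>)\<bar>"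
    using c by (simp add: abs_mult)
  also have "2 * pi * c * (real_of_int (- n) / c - Im \<epsilon>) = - (Im (charge p \<epsilon>) + 2 * pi * of_int n)"
    using c by (simp add: charge_def c_def field_simps)
    finally show ?thesis by simp
  qed
  ultimately show ?thesis by blast
qed

text \<open>
  The two shifts differ by \<open>s / p\<close>, so the frequencies that are multiples of \<open>p\<close> cancel; these are
  the ones on which \<^const>\<open>B\<close> imposes no condition.
\<close>
lemma numerator_tendsto:
  assumes p: "p \<ge> 2" and \<epsilon>: "Re \<epsilon> > B p \<epsilon>" "Re \<epsilon> \<noteq> 0"
  defines "b \<equiv> charge p \<epsilon>"
  shows "((\<lambda>y. partial_theta b (2 * pi * real p * y) (x - real s / (2 * real p)) -
               partial_theta b (2 * pi * real p * y) (x + real s / (2 * real p)))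
     \<longlongrightarrow> (exp (- (b * of_real (x - real s / (2 * real p)))) - exp (- (b * of_real (x + real s / (2 * real p)))))
           / (1 - exp (- b))) (at_right 0)"
proof -
  have Re_b: "Re b = 2 * pi * sqrt (2 * real p) * Re \<epsilon>" by (simp add: b_def charge_def)
  have same: "exp (2 * of_real pi * \<i> * of_int n * of_real (x - real s / (2 * real p)))
      = exp (2 * of_real pi * \<i> * of_int n * of_real (x + real s / (2 * real p)))" if n: "int p dvd n" for n
  proof -
    obtain l where l: "n = int p * l" using n by blast
    have "real_of_int n * (x + real s / (2 * real p)) = real_of_int n * (x - real s / (2 * real p)) + real_of_int (l * int s)"
      using p by (simp add: l field_simps)
    hence "exp (2 * of_real pi * \<i> * of_real (real_of_int n * (x + real s / (2 * real p))))
        = exp (2 * of_real pi * \<i> * of_real (real_of_int n * (x - real s / (2 * real p)))) *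
          exp (2 * of_real pi * \<i> * of_int (l * int s))"
      by (simp only: of_real_add ring_distribs exp_add of_real_of_int_eq)
    moreover have "exp (2 * of_real pi * \<i> * of_int (l * int s)) = 1"
      by (subst exp_two_pi_i_eq_1_iff) (rule Ints_of_int)
    ultimately show ?thesis by (simp add: mult.assoc)
  qed
  have "((\<lambda>t. partial_theta b t (x - real s / (2 * real p)) - partial_theta b t (x + real s / (2 * real p)))
     \<longlongrightarrow> (exp (- (b * of_real (x - real s / (2 * real p)))) - exp (- (b * of_real (x + real s / (2 * real p)))))
           / (1 - exp (- b))) (at_right 0)"
  proof (rule partial_theta_diff_tendsto)
    show "Re b \<noteq> 0" using Re_b \<epsilon> p by simp
    assume "Re b < 0"
    hence "Re \<epsilon> < 0" using Re_b p by (simp add: mult_less_0_iff)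
    from charge_gap[OF p \<epsilon>(1) this] obtain m where
      "m > \<bar>Re b\<bar>" "\<And>n. \<not> int p dvd n \<Longrightarrow> m \<le> \<bar>Im b + 2 * pi * of_int n\<bar>"
      unfolding b_def by blast
    thus "\<exists>m > \<bar>Re b\<bar>. \<forall>n. exp (2 * of_real pi * \<i> * of_int n * of_real (x - real s / (2 * real p)))
        \<noteq> exp (2 * of_real pi * \<i> * of_int n * of_real (x + real s / (2 * real p)))
        \<longrightarrow> m \<le> \<bar>Im b + 2 * pi * of_int n\<bar>"
      using same by blast
  qed
  moreover have "2 * pi * real p > 0" using p by simp
  ultimately show ?thesis by (rule filterlim_compose[OF _ filterlim_mult_at_right_0])
qed

lemma exp_diff_conv_sin: "exp v - exp (- v) = - 2 * \<i> * sin (\<i> * v)" for v :: complex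
  by (simp add: sin_exp_eq field_simps)

lemma sin_ii_nonzero:
  assumes "Re v \<noteq> 0" shows "sin (\<i> * v) \<noteq> 0"
proof
  assume "sin (\<i> * v) = 0"
  hence "exp v = exp (- v)" using exp_diff_conv_sin[of v] by simp
  hence "norm (exp v) = norm (exp (- v))" by simp
  thus False using assms by (simp add: norm_exp_eq_Re)
qed

section \<open>Regularised quantum dimensions\<close>
theorem proposition11:
  fixes p :: nat and \<epsilon> :: complex
  assumes "p \<ge> 2" and "Re \<epsilon> > B p \<epsilon>" and "Re \<epsilon> \<noteq> 0"
  shows "(\<forall>l::complex. has_qdim p \<epsilon> (Fock l)
            (exp (2 * of_real pi * \<epsilon> * (l - of_real (alpha0 p) / 2)) *
             (sin (\<i> * of_real pi * of_real (sqrt (2 * real p)) * \<epsilon>) /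
              sin (2 * of_real pi * \<i> * (\<epsilon> / of_real (sqrt (2 * real p))))))) \<and>
         (\<forall>(r::int) (s::nat). 1 \<le> s \<and> s \<le> p \<longrightarrow> has_qdim p \<epsilon> (Irr r s)
            (exp (of_real pi * \<epsilon> * of_int (r - 1) * of_real (sqrt (2 * real p))) *
             (sin (2 * of_real pi * (of_nat s * \<epsilon> * \<i> / of_real (sqrt (2 * real p)))) /
              sin (2 * of_real pi * (\<epsilon> * \<i> / of_real (sqrt (2 * real p)))))))"
proof -
  define c where "c = sqrt (2 * real p)"
  have c: "c > 0" "c\<^sup>2 = 2 * real p" using assms(1) by (auto simp: c_def)
  define b where "b = charge p \<epsilon>"
  define w where "w = 2 * of_real pi * \<epsilon> / of_real c"
  have b_eq: "b = 2 * of_real pi * \<epsilon> * of_real c" by (simp add: b_def charge_def c_def)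
  have b_w: "b * of_real (real s / (2 * real p)) = of_nat s * w" for s
    unfolding c(2)[symmetric] b_eq w_def using c(1) by (simp add: power2_eq_square)
  have Re_w: "Re w \<noteq> 0" unfolding w_def Re_divide_of_real using c(1) assms(3) by simp
  have Re_b: "Re b \<noteq> 0" unfolding b_eq using c(1) assms(3) by simp
  \<comment> \<open>The limit of \<open>\<eta>\<close> times the character of \<open>M\<^sub>r\<^sub>,\<^sub>s\<close>, and that product as a function of \<open>y\<close>.\<close>
  define V where "V r s = exp (b * of_real ((real_of_int r - 2) / 2)) * (- 2 * \<i> * sin (\<i> * (of_nat s * w))) / (1 - exp (- b))"
    for r :: int and s :: nat
  define num where "num r s y =
    partial_theta b (2 * pi * real p * y) ((2 - real_of_int r) / 2 - real s / (2 * real p)) -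
    partial_theta b (2 * pi * real p * y) ((2 - real_of_int r) / 2 + real s / (2 * real p))" for r :: int and s y
  have num: "(num r s \<longlongrightarrow> V r s) (at_right 0)" for r s
  proof -
    define x where "x = (2 - real_of_int r) / 2"
    have "exp (- (b * of_real (x - real s / (2 * real p)))) - exp (- (b * of_real (x + real s / (2 * real p))))
        = exp (- (b * of_real x)) * (exp (of_nat s * w) - exp (- (of_nat s * w)))"
      by (simp only: of_real_add of_real_diff ring_distribs b_w exp_add[symmetric]) (simp add: algebra_simps)
    also have "- (b * of_real x) = b * of_real ((real_of_int r - 2) / 2)"
      by (simp add: x_def field_simps)
    finally show ?thesis
      using numerator_tendsto[OF assms, of x s] unfolding exp_diff_conv_sin
      by (simp only: V_def num_def[abs_def] b_def x_def)
  qed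
  have ch: "reg_ch p \<epsilon> (Irr r s) (\<i> * of_real y) = num r s y / dedekind_eta (\<i> * of_real y)" if "y > 0" for r s y
    using reg_ch_Irr[OF _ that, of p \<epsilon> r s] assms(1) by (simp add: num_def b_def)
  have nz_b: "1 - exp (- b) \<noteq> 0"
  proof
    assume "1 - exp (- b) = 0"
    hence "norm (exp (- b)) = 1" by simp
    thus False using Re_b by (simp add: norm_exp_eq_Re)
  qed
  have nz_w: "sin (\<i> * w) \<noteq> 0" by (rule sin_ii_nonzero[OF Re_w])
  have V11: "V 1 1 \<noteq> 0" using nz_b nz_w by (simp add: V_def)
  show ?thesis
  proof (intro conjI allI impI)
    fix l :: complex
    define A where "A = exp (2 * of_real pi * \<epsilon> * (l - of_real (alpha0 p) / 2))"
    define \<mu> where "\<mu> = (l - of_real (alpha0 p) / 2)\<^sup>2 / 2"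
    have "has_qdim p \<epsilon> (Fock l) (A / V 1 1)"
    proof (rule has_qdimI[OF _ ch _ num V11])
      show "reg_ch p \<epsilon> (Fock l) (\<i> * of_real y) = A * qpow (\<i> * of_real y) \<mu> / dedekind_eta (\<i> * of_real y)" for y
        by (simp add: A_def \<mu>_def)
      show "((\<lambda>y. A * qpow (\<i> * of_real y) \<mu>) \<longlongrightarrow> A) (at_right 0)"
        unfolding qpow_def by (auto intro!: tendsto_eq_intros)
    qed
    also have "A / V 1 1 = A * (sin (\<i> * (b / 2)) / sin (\<i> * w))"
    proof -
      \<comment> \<open>The denominator of the geometric series moves to the numerator and becomes the sine there.\<close>
      have "1 - exp (- b) = exp (- (b / 2)) * (exp (b / 2) - exp (- (b / 2)))"
        by (simp add: ring_distribs exp_add[symmetric])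
      also have "\<dots> = exp (- (b / 2)) * (- 2 * \<i> * sin (\<i> * (b / 2)))"
        by (simp only: exp_diff_conv_sin)
      finally show ?thesis using nz_w by (simp add: V_def)
    qed
    also have "\<i> * (b / 2) = \<i> * of_real pi * of_real c * \<epsilon>" by (simp add: b_eq)
    also have "\<i> * w = 2 * of_real pi * \<i> * (\<epsilon> / of_real c)" by (simp add: w_def)
    finally show "has_qdim p \<epsilon> (Fock l)
            (exp (2 * of_real pi * \<epsilon> * (l - of_real (alpha0 p) / 2)) *
             (sin (\<i> * of_real pi * of_real (sqrt (2 * real p)) * \<epsilon>) /
              sin (2 * of_real pi * \<i> * (\<epsilon> / of_real (sqrt (2 * real p))))))"
      by (simp only: A_def c_def)
  next
    fix r :: int and s :: nat
    have "has_qdim p \<epsilon> (Irr r s) (V r s / V 1 1)"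
      by (rule has_qdimI[OF ch ch num num V11])
    also have "V r s / V 1 1 = exp (b * of_real ((real_of_int r - 1) / 2)) * (sin (\<i> * (of_nat s * w)) / sin (\<i> * w))"
    proof -
      have "b * of_real ((real_of_int r - 2) / 2) = b * of_real ((real_of_int r - 1) / 2) + b * of_real ((real_of_int 1 - 2) / 2)"
        by (simp add: field_simps)
      hence "V r s = exp (b * of_real ((real_of_int r - 1) / 2)) * exp (b * of_real ((real_of_int 1 - 2) / 2)) *
          (- 2 * \<i> * sin (\<i> * (of_nat s * w))) / (1 - exp (- b))"
        by (simp only: V_def exp_add)
      moreover have "V 1 1 = exp (b * of_real ((real_of_int 1 - 2) / 2)) * (- 2 * \<i> * sin (\<i> * w)) / (1 - exp (- b))"
        by (simp add: V_def)
      ultimately show ?thesis using nz_w nz_b by (simp del: of_real_divide)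
    qed
    also have "b * of_real ((real_of_int r - 1) / 2) = of_real pi * \<epsilon> * of_int (r - 1) * of_real c"
      by (simp add: b_eq)
    also have "\<i> * (of_nat s * w) = 2 * of_real pi * (of_nat s * \<epsilon> * \<i> / of_real c)" by (simp add: w_def)
    also have "\<i> * w = 2 * of_real pi * (\<epsilon> * \<i> / of_real c)" by (simp add: w_def)
    finally show "has_qdim p \<epsilon> (Irr r s)
            (exp (of_real pi * \<epsilon> * of_int (r - 1) * of_real (sqrt (2 * real p))) *
             (sin (2 * of_real pi * (of_nat s * \<epsilon> * \<i> / of_real (sqrt (2 * real p)))) /
              sin (2 * of_real pi * (\<epsilon> * \<i> / of_real (sqrt (2 * real p))))))"
      by (simp only: c_def)
  qed
qed

end
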